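(* Let $\nu\ge 0$ be an integer and let $a,m$ be positive integers with $a<m$. Then, as formal power series in $q$, \[ \sum_{n=0}^{\infty}M(a,m,\nu;n)q^n=q^{a+\nu(m\nu+m+2a)/2}\sum_{\tau=0}^{\infty}\frac{q^{\tau(m\nu+m\tau+m+a)}}{(q^m;q^m)_\tau\,(q^a;q^m)_{\nu+\tau+1}}. \]
   Context: Notation: $(x;q)_\infty=\prod_{k\ge0}(1-xq^k)$ and $(x;q)_n=\prod_{k=0}^{n-1}(1-xq^k)$. Definition of $M(a,m,\nu;n)$ (for integers $\nu\ge0$, $1\le a<m$, $n\ge0$): consider a partition $\lambda_1\ge\lambda_2\ge\dots\ge\lambda_k$ of $n$ all of whose parts are $\equiv a\pmod m$. In its $m$-modular Young diagram the part $\lambda_i$ is drawn as a row of $\ell_i=(\lambda_i-a)/m+1$ boxes (one box containing $a$, in the first column, and the others containing $m$). The $(\nu+2)$-Durfee rectangle is the largest rectangle of height $t$ and width $t+\nu+2$ fitting in this diagram, i.e. $t$ is the largest integer $0\le t\le k$ with $\ell_t\ge t+\nu+2$ ($t=0$ always allowed). Then $M(a,m,\nu;n)$ is the number of partitions of $n$ into parts $\equiv a\pmod m$ such that every part $\equiv a \pmod m$ that is $\le m\nu+a$ (i.e. each of $a,a+m,\dots,a+m\nu$) occurs at least once, and every part below the Durfee rectangle is strictly shorter than its width, i.e. $\ell_i<t+\nu+2$ for all $i>t$. *)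

theory Defs
  imports
    "HOL-Computational_Algebra.Formal_Power_Series"
    "HOL-Number_Theory.Cong"
begin

text \<open>The finite \<open>q\<close>-Pochhammer symbol \<open>(x; q)\<^sub>n\<close>.\<close>

definition qpochhammer :: "nat \<Rightarrow> 'a::comm_ring_1 \<Rightarrow> 'a \<Rightarrow> 'a" where
  "qpochhammer n x q = (\<Prod>k<n. 1 - x * q ^ k)"

text \<open>A partition is the list of its parts in weakly decreasing order, so the part
  \<open>\<lambda>\<^sub>i\<close> (\<open>i \<ge> 1\<close>) is \<open>xs ! (i - 1)\<close>.\<close>

definition is_partition :: "nat \<Rightarrow> nat list \<Rightarrow> bool" where
  "is_partition n xs \<longleftrightarrow> sorted_wrt (\<ge>) xs \<and> (\<forall>x\<in>set xs. x > 0) \<and> sum_list xs = n"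

text \<open>Number of boxes in the row of the \<open>m\<close>-modular Young diagram that represents a part
  \<open>x \<equiv> a (mod m)\<close>. For such a positive part and \<open>1 \<le> a < m\<close> we have \<open>x \<ge> a\<close>, so the
  truncated subtraction and the division are exact.\<close>

definition row_length :: "nat \<Rightarrow> nat \<Rightarrow> nat \<Rightarrow> nat" where
  "row_length a m x = (x - a) div m + 1"

text \<open>Height of the \<open>d\<close>-Durfee rectangle (height \<open>t\<close>, width \<open>t + d\<close>) of the \<open>m\<close>-modular
  diagram.\<close>

definition durfee_height :: "nat \<Rightarrow> nat \<Rightarrow> nat \<Rightarrow> nat list \<Rightarrow> nat" where
  "durfee_height a m d xs =
     Max {t. t \<le> length xs \<and> (t = 0 \<or> row_length a m (xs ! (t - 1)) \<ge> t + d)}"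

text \<open>In the last condition the 0-based indices \<open>i \<ge> t\<close> are exactly the rows below the
  Durfee rectangle.\<close>

definition M_partitions :: "nat \<Rightarrow> nat \<Rightarrow> nat \<Rightarrow> nat \<Rightarrow> nat list set" where
  "M_partitions a m \<nu> n =
     {xs. is_partition n xs
        \<and> (\<forall>x\<in>set xs. [x = a] (mod m))
        \<and> (\<forall>j\<le>\<nu>. a + m * j \<in> set xs)
        \<and> (let t = durfee_height a m (\<nu> + 2) xs
           in \<forall>i. t \<le> i \<and> i < length xs \<longrightarrow> row_length a m (xs ! i) < t + \<nu> + 2)}"

definition M :: "nat \<Rightarrow> nat \<Rightarrow> nat \<Rightarrow> nat \<Rightarrow> nat" where
  "M a m \<nu> n = card (M_partitions a m \<nu> n)"

end

theory Submission
  imports Defs "HOL-Library.Multiset"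
begin

unbundle fps_syntax

text \<open>
  Cut the diagram below its Durfee rectangle, of height \<open>\<tau>\<close>. The top piece consists of exactly
  \<open>\<tau>\<close> parts, all at least \<open>a + m (\<tau> + \<nu> + 1)\<close>; it contributes
  \<open>q\<^bsup>\<tau>(m\<nu> + m\<tau> + m + a)\<^esup> / (q\<^sup>m; q\<^sup>m)\<^sub>\<tau>\<close>. The bottom piece is
  an arbitrary multiset of the parts \<open>a + m j\<close>, \<open>j \<le> \<tau> + \<nu>\<close>, on top of one mandatory copy of
  each of \<open>a, a + m, \<dots>, a + m \<nu>\<close>; it contributes
  \<open>q\<^bsup>a + \<nu>(m\<nu> + m + 2a)/2\<^esup> / (q\<^sup>a; q\<^sup>m)\<^sub>\<nu>\<^sub>+\<^sub>\<tau>\<^sub>+\<^sub>1\<close>.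
\<close>

section \<open>Generating functions of sets of multisets\<close>

text \<open>\<open>card\<close> is 0 on infinite sets, so a coefficient is a genuine count only when
  finitely many members of \<open>S\<close> share that sum. Excluding the part 0 guarantees
  this.\<close>

definition mset_gf :: "nat multiset set \<Rightarrow> 'a::comm_ring_1 fps" where
  "mset_gf S = Abs_fps (\<lambda>n. of_nat (card {A \<in> S. sum_mset A = n}))"

lemma size_le_sum_mset:
  fixes A :: "nat multiset"
  assumes "0 \<notin># A"
  shows "size A \<le> sum_mset A"
  using assms by (induction A) auto

text \<open>Without the part 0, a multiset of sum \<open>n\<close> has at most \<open>n\<close>
  elements, each at most \<open>n\<close>.\<close>

lemma finite_msets_sum:
  assumes "\<And>A. A \<in> S \<Longrightarrow> (0::nat) \<notin># A"
  shows "finite {A \<in> S. sum_mset A = n}"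
proof (rule finite_subset)
  show "{A \<in> S. sum_mset A = n} \<subseteq> mset ` {xs. set xs \<subseteq> {..n} \<and> length xs \<le> n}"
  proof
    fix A assume A: "A \<in> {A \<in> S. sum_mset A = n}"
    obtain xs where xs: "A = mset xs" by (metis ex_mset)
    have "size A \<le> n" using A assms size_le_sum_mset by auto
    moreover have "x \<le> n" if "x \<in># A" for x
      using A that by (auto dest: multi_member_split)
    ultimately show "A \<in> mset ` {xs. set xs \<subseteq> {..n} \<and> length xs \<le> n}"
      using xs by auto
  qed
qed (simp add: finite_lists_length_le)

lemma mset_gf_empty_mset: "mset_gf {{#}} = 1"
proof (rule fps_ext)
  fix n :: nat
  have "{A \<in> {{#}}. sum_mset A = n} = (if n = 0 then {{#}} else {})" by auto
  then show "mset_gf {{#}} $ n = (1 :: 'a fps) $ n" by (simp add: mset_gf_def)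
qed

lemma mset_gf_Un:
  assumes "S \<inter> T = {}" and "\<And>A. A \<in> S \<union> T \<Longrightarrow> 0 \<notin># A"
  shows "mset_gf (S \<union> T) = mset_gf S + mset_gf T"
proof (rule fps_ext)
  fix n :: nat
  have "{A \<in> S \<union> T. sum_mset A = n} = {A \<in> S. sum_mset A = n} \<union> {A \<in> T. sum_mset A = n}"
    by auto
  then show "mset_gf (S \<union> T) $ n = (mset_gf S + mset_gf T) $ n"
    using assms by (simp add: mset_gf_def, subst card_Un_disjoint)
      (auto intro!: finite_msets_sum)
qed

text \<open>Serves three kinds of map: adding one part, adding \<open>m\<close> to every part of a
  multiset of fixed size, and adding the mandatory parts.\<close>

lemma mset_gf_image_shift:
  assumes "inj_on f S" and "\<And>A. A \<in> S \<Longrightarrow> sum_mset (f A) = k + sum_mset A"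
  shows "mset_gf (f ` S) = fps_X ^ k * mset_gf S"
proof (rule fps_ext)
  fix n :: nat
  have "card {A \<in> f ` S. sum_mset A = n} = (if n < k then 0 else card {A \<in> S. sum_mset A = n - k})"
  proof (cases "n < k")
    case True
    then have "{A \<in> f ` S. sum_mset A = n} = {}" using assms(2) by auto
    then show ?thesis using True by (simp only: card.empty if_True)
  next
    case False
    then have "{A \<in> f ` S. sum_mset A = n} = f ` {A \<in> S. sum_mset A = n - k}"
      using assms(2) by auto
    moreover have "inj_on f {A \<in> S. sum_mset A = n - k}"
      using assms(1) by (rule inj_on_subset) auto
    ultimately show ?thesis using False by (simp add: card_image)
  qed
  then show "mset_gf (f ` S) $ n = (fps_X ^ k * mset_gf S) $ n"
    by (simp add: mset_gf_def fps_X_power_mult_nth)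
qed

text \<open>The Cauchy product counts pairs by the sum \<open>i\<close> of the first component;
  injectivity makes counting pairs the same as counting the multisets \<open>A + B\<close>.\<close>

lemma mset_gf_plus:
  assumes inj: "inj_on (\<lambda>(A, B). A + B) (S \<times> T)"
    and pos: "\<And>A. A \<in> S \<union> T \<Longrightarrow> 0 \<notin># A"
  shows "mset_gf ((\<lambda>(A, B). A + B) ` (S \<times> T)) = mset_gf S * mset_gf T"
proof (rule fps_ext)
  fix n :: nat
  define P where "P i = {A \<in> S. sum_mset A = i} \<times> {B \<in> T. sum_mset B = n - i}" for i
  have eq: "{A \<in> (\<lambda>(A, B). A + B) ` (S \<times> T). sum_mset A = n} = (\<lambda>(A, B). A + B) ` (\<Union>i\<in>{0..n}. P i)"
    by (auto simp: P_def image_iff)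
  have "inj_on (\<lambda>(A, B). A + B) (\<Union>i\<in>{0..n}. P i)"
    using inj by (rule inj_on_subset) (auto simp: P_def)
  then have "card {A \<in> (\<lambda>(A, B). A + B) ` (S \<times> T). sum_mset A = n} = card (\<Union>i\<in>{0..n}. P i)"
    unfolding eq by (rule card_image)
  also have "\<dots> = (\<Sum>i=0..n. card (P i))"
    using pos by (intro card_UN_disjoint)
      (auto simp: P_def intro!: finite_cartesian_product finite_msets_sum)
  finally show "mset_gf ((\<lambda>(A, B). A + B) ` (S \<times> T)) $ n = (mset_gf S * mset_gf T) $ n"
    by (simp add: mset_gf_def fps_mult_nth P_def card_cartesian_product)
qed

section \<open>Partitions with restricted parts\<close>

text \<open>A multiset over \<open>insert s S\<close> either avoids \<open>s\<close> or arises from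
  another such multiset by adding one copy of \<open>s\<close>. Multiplying its generating function
  by \<open>1 - fps_X ^ s\<close> therefore leaves the one for \<open>S\<close>. The product form
  avoids division, so any commutative coefficient ring will do.\<close>

lemma mset_gf_parts_in:
  assumes "finite S" and "0 \<notin> S"
  shows "mset_gf {A. set_mset A \<subseteq> S} * (\<Prod>s\<in>S. 1 - fps_X ^ s) = 1"
  using assms
proof (induction S)
  case empty
  then show ?case by (simp add: mset_gf_empty_mset)
next
  case (insert s S)
  define U where "U = {A. set_mset A \<subseteq> insert s S}"
  have split: "U = {A. set_mset A \<subseteq> S} \<union> add_mset s ` U"
  proof (intro equalityI subsetI)
    fix A assume A: "A \<in> U"
    show "A \<in> {A. set_mset A \<subseteq> S} \<union> add_mset s ` U"
    proof (cases "s \<in># A")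
      case True
      then obtain B where "A = add_mset s B" by (blast dest: multi_member_split)
      then show ?thesis using A by (auto simp: U_def)
    qed (use A in \<open>auto simp: U_def\<close>)
  qed (auto simp: U_def)
  have "mset_gf U = mset_gf {A. set_mset A \<subseteq> S} + (mset_gf (add_mset s ` U) :: 'a fps)"
    by (subst split, rule mset_gf_Un) (use insert in \<open>auto simp: U_def\<close>)
  also have "mset_gf (add_mset s ` U) = fps_X ^ s * (mset_gf U :: 'a fps)"
    by (rule mset_gf_image_shift) (auto intro: inj_onI)
  finally have "mset_gf U * (1 - fps_X ^ s) = (mset_gf {A. set_mset A \<subseteq> S} :: 'a fps)"
    by (simp add: algebra_simps)
  then show ?case
    using insert by (simp add: U_def mult.assoc[symmetric])
qed

lemma mset_gf_parts_in_progression: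
  assumes "0 < a" and "0 < m"
  shows "mset_gf {A. set_mset A \<subseteq> (\<lambda>j. a + m * j) ` {..<k}}
           * qpochhammer k (fps_X ^ a) (fps_X ^ m) = 1"
proof -
  have inj: "inj_on (\<lambda>j. a + m * j) {..<k}" using assms by (auto intro: inj_onI)
  have "qpochhammer k (fps_X ^ a) (fps_X ^ m)
          = (\<Prod>s\<in>(\<lambda>j. a + m * j) ` {..<k}. 1 - fps_X ^ s :: 'a fps)"
    by (simp add: qpochhammer_def prod.reindex[OF inj] power_add power_mult)
  then show ?thesis using assms by (auto intro!: mset_gf_parts_in)
qed

text \<open>Either the smallest admissible part \<open>b\<close> occurs and can be removed, or \<open>m\<close> can be
  subtracted from each of the \<open>t\<close> parts.\<close>

lemma multisets_of_size_progression_Suc: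
  fixes b m t :: nat
  defines "S \<equiv> range (\<lambda>j. b + m * j)"
  shows "multisets_of_size S (Suc t)
    = add_mset b ` multisets_of_size S t \<union> image_mset ((+) m) ` multisets_of_size S (Suc t)"
proof (intro equalityI subsetI)
  fix A assume A: "A \<in> multisets_of_size S (Suc t)"
  show "A \<in> add_mset b ` multisets_of_size S t \<union> image_mset ((+) m) ` multisets_of_size S (Suc t)"
  proof (cases "b \<in># A")
    case True
    then obtain B where "A = add_mset b B" by (blast dest: multi_member_split)
    then show ?thesis using A by (auto simp: multisets_of_size_def)
  next
    case False
    \<comment> \<open>As \<open>b\<close> does not occur, the index \<open>j\<close> of each part is
      positive, so the truncated \<open>x - m\<close> is exact and stays in
      \<open>S\<close>.\<close>
    have shift: "x - m \<in> S \<and> m + (x - m) = x" if "x \<in># A" for x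
    proof -
      obtain j where j: "x = b + m * j"
        using A \<open>x \<in># A\<close> unfolding multisets_of_size_def S_def by blast
      then obtain i where "j = Suc i"
        using False \<open>x \<in># A\<close> by (cases j) auto
      then show ?thesis using j by (auto simp: S_def)
    qed
    define B where "B = image_mset (\<lambda>x. x - m) A"
    have "image_mset ((+) m) B = image_mset id A"
      unfolding B_def image_mset.compositionality
      by (rule image_mset_cong) (use shift in auto)
    moreover have "B \<in> multisets_of_size S (Suc t)"
      using A shift by (auto simp: multisets_of_size_def B_def)
    ultimately show ?thesis by force
  qed
next
  have "b \<in> S" by (auto simp: S_def intro: range_eqI[of _ _ 0])
  moreover have "m + x \<in> S" if "x \<in> S" for x
    using that by (auto simp: S_def intro: range_eqI[of _ _ "Suc _"])
  ultimately show "A \<in> multisets_of_size S (Suc t)"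
    if "A \<in> add_mset b ` multisets_of_size S t \<union> image_mset ((+) m) ` multisets_of_size S (Suc t)"
    for A
    using that by (auto simp: multisets_of_size_def subset_iff)
qed

lemma sum_mset_image_plus:
  fixes A :: "nat multiset"
  shows "sum_mset (image_mset ((+) m) A) = m * size A + sum_mset A"
  by (induction A) auto

text \<open>The preceding dichotomy gives \<open>G (Suc t) = fps_X ^ b * G t + fps_X ^ (m * Suc t) *
  G (Suc t)\<close>, so each further part contributes a factor \<open>fps_X ^ b\<close> and a
  denominator \<open>1 - fps_X ^ (m * Suc t)\<close>.\<close>

lemma mset_gf_multisets_of_size_progression:
  assumes "0 < b" and "0 < m"
  shows "mset_gf (multisets_of_size (range (\<lambda>j. b + m * j)) t)
           * qpochhammer t (fps_X ^ m) (fps_X ^ m) = fps_X ^ (t * b)"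
proof (induction t)
  case 0
  show ?case by (simp add: qpochhammer_def mset_gf_empty_mset)
next
  case (Suc t)
  define S where "S = range (\<lambda>j. b + m * j)"
  define G :: "nat \<Rightarrow> 'a fps" where "G t = mset_gf (multisets_of_size S t)" for t
  have ge: "b \<le> x" if "A \<in> multisets_of_size S k" "x \<in># A" for x A k
    using that by (auto simp: multisets_of_size_def S_def)
  have "G (Suc t) = mset_gf (add_mset b ` multisets_of_size S t)
          + mset_gf (image_mset ((+) m) ` multisets_of_size S (Suc t))"
    unfolding G_def S_def
  proof (subst multisets_of_size_progression_Suc, rule mset_gf_Un, fold S_def)
    show "add_mset b ` multisets_of_size S t \<inter> image_mset ((+) m) ` multisets_of_size S (Suc t) = {}"
    proof -
      \<comment> \<open>After adding \<open>m > 0\<close>, every part exceeds \<open>b\<close>,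
        which separates the two families.\<close>
      have "b \<notin># image_mset ((+) m) A" if "A \<in> multisets_of_size S (Suc t)" for A
        using ge[OF that] assms by fastforce
      then show ?thesis by (metis (no_types, lifting) disjoint_iff imageE union_single_eq_member)
    qed
  next
    fix A assume "A \<in> add_mset b ` multisets_of_size S t
                    \<union> image_mset ((+) m) ` multisets_of_size S (Suc t)"
    then show "0 \<notin># A" using ge assms by fastforce
  qed
  also have "mset_gf (add_mset b ` multisets_of_size S t) = fps_X ^ b * G t"
    unfolding G_def by (rule mset_gf_image_shift) (auto intro: inj_onI)
  also have "mset_gf (image_mset ((+) m) ` multisets_of_size S (Suc t)) = fps_X ^ (m * Suc t) * G (Suc t)"
    unfolding G_def
  proof (rule mset_gf_image_shift)
    show "inj_on (image_mset ((+) m)) (multisets_of_size S (Suc t))"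
      by (rule inj_on_subset[OF multiset.inj_map]) auto
    show "sum_mset (image_mset ((+) m) A) = m * Suc t + sum_mset A"
      if "A \<in> multisets_of_size S (Suc t)" for A
      using that by (simp add: sum_mset_image_plus multisets_of_size_def)
  qed
  finally have "G (Suc t) * (1 - fps_X ^ (m * Suc t)) = fps_X ^ b * G t"
    by (simp add: algebra_simps)
  \<comment> \<open>Factors are numbered from 0: with both arguments equal to
    \<open>fps_X ^ m\<close>, factor number \<open>t\<close> is
    \<open>1 - fps_X ^ (m * Suc t)\<close>.\<close>
  moreover have "qpochhammer (Suc t) (fps_X ^ m) (fps_X ^ m)
      = (1 - fps_X ^ (m * Suc t)) * (qpochhammer t (fps_X ^ m) (fps_X ^ m) :: 'a fps)"
    by (simp add: qpochhammer_def power_add power_mult mult.commute)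
  ultimately have "G (Suc t) * qpochhammer (Suc t) (fps_X ^ m) (fps_X ^ m)
      = fps_X ^ b * (G t * qpochhammer t (fps_X ^ m) (fps_X ^ m))"
    by (metis mult.assoc)
  then show ?case
    using Suc by (simp add: G_def S_def power_add)
qed

section \<open>Decomposition along the Durfee rectangle\<close>

text \<open>The part \<open>a + m * j\<close> has \<open>j + 1\<close> boxes, so the filter keeps
  the rows of at least \<open>t + \<nu> + 2\<close> boxes. Asking for exactly \<open>t\<close> of
  them says at once that the rectangle of height \<open>t\<close> fits and that all rows below it
  are strictly shorter than its width.\<close>

definition durfee_class :: "nat \<Rightarrow> nat \<Rightarrow> nat \<Rightarrow> nat \<Rightarrow> nat multiset set" where
  "durfee_class a m \<nu> t =
     {A. set_mset A \<subseteq> range (\<lambda>j. a + m * j) \<and> (\<lambda>j. a + m * j) ` {..\<nu>} \<subseteq> set_mset A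
        \<and> size {#x \<in># A. a + m * (t + \<nu> + 1) \<le> x#} = t}"

text \<open>\<open>b\<close> is the smallest part as wide as the rectangle. Filtering at
  \<open>b\<close> recovers both summands, which gives injectivity. The mandatory parts have index
  at most \<open>\<nu>\<close>, hence lie below \<open>b\<close> and constrain the bottom piece
  only.\<close>

lemma durfee_class_eq_image:
  fixes a m \<nu> t :: nat
  assumes "0 < m"
  defines "b \<equiv> a + m * (t + \<nu> + 1)"
  defines "T \<equiv> {B. set_mset B \<subseteq> (\<lambda>j. a + m * j) ` {..<\<nu> + t + 1}
                  \<and> (\<lambda>j. a + m * j) ` {..\<nu>} \<subseteq> set_mset B}"
  shows "durfee_class a m \<nu> t
           = (\<lambda>(A, B). A + B) ` (multisets_of_size (range (\<lambda>j. b + m * j)) t \<times> T)" (is "?L = ?R")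
    and "inj_on (\<lambda>(A, B). A + B) (multisets_of_size (range (\<lambda>j. b + m * j)) t \<times> T)"
proof -
  have big: "b \<le> a + m * j \<longleftrightarrow> t + \<nu> + 1 \<le> j" for j
    using assms(1) by (simp only: b_def add_le_cancel_left mult_le_cancel1) simp
  have range_b: "a + m * j \<in> range (\<lambda>j. b + m * j)" if "t + \<nu> + 1 \<le> j" for j
    using that by (auto simp: b_def algebra_simps dest!: le_Suc_ex intro!: range_eqI[of _ _ "j - (t + \<nu> + 1)"])
  have range_b': "range (\<lambda>j. b + m * j) \<subseteq> range (\<lambda>j. a + m * j)"
  proof
    fix x assume "x \<in> range (\<lambda>j. b + m * j)"
    then obtain j where "x = b + m * j" by blast
    then have "x = a + m * (t + \<nu> + 1 + j)" by (simp add: b_def algebra_simps)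
    then show "x \<in> range (\<lambda>j. a + m * j)" by blast
  qed
  have filter_top: "{#x \<in># A + B. b \<le> x#} = A" "{#x \<in># A + B. \<not> b \<le> x#} = B"
    if "A \<in> multisets_of_size (range (\<lambda>j. b + m * j)) t" "B \<in> T" for A B
  proof -
    have 1: "b \<le> x" if "x \<in># A" for x
      using that \<open>A \<in> _\<close> by (auto simp: multisets_of_size_def)
    have 2: "\<not> b \<le> x" if "x \<in># B" for x
      using that \<open>B \<in> T\<close> by (auto simp: T_def big)
    show "{#x \<in># A + B. b \<le> x#} = A" "{#x \<in># A + B. \<not> b \<le> x#} = B"
      using 1 2 by (auto simp: multiset_eq_iff simp flip: not_in_iff)
  qed
  show "?L = ?R"
  proof (intro equalityI subsetI)
    fix C assume C: "C \<in> ?L"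
    have parts: "set_mset C \<subseteq> range (\<lambda>j. a + m * j)" "(\<lambda>j. a + m * j) ` {..\<nu>} \<subseteq> set_mset C"
      and height: "size {#x \<in># C. b \<le> x#} = t"
      using C unfolding durfee_class_def b_def by auto
    define A where "A = {#x \<in># C. b \<le> x#}"
    define B where "B = {#x \<in># C. \<not> b \<le> x#}"
    have "A \<in> multisets_of_size (range (\<lambda>j. b + m * j)) t"
      using parts height range_b by (auto simp: A_def multisets_of_size_def big)
    moreover have "B \<in> T"
    proof -
      have "x \<in> (\<lambda>j. a + m * j) ` {..<\<nu> + t + 1}" if "x \<in># C" "\<not> b \<le> x" for x
      proof -
        obtain j where "x = a + m * j" using parts(1) \<open>x \<in># C\<close> by blast
        then show ?thesis using \<open>\<not> b \<le> x\<close> by (auto simp: big)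
      qed
      then show ?thesis using parts(2) by (auto simp: B_def T_def big)
    qed
    moreover have "C = A + B" by (simp add: A_def B_def)
    ultimately show "C \<in> ?R" by auto
  next
    fix C assume "C \<in> ?R"
    then obtain A B where AB: "A \<in> multisets_of_size (range (\<lambda>j. b + m * j)) t" "B \<in> T" "C = A + B"
      by auto
    have "size {#x \<in># C. b \<le> x#} = t"
      using filter_top(1)[OF AB(1,2)] AB by (simp add: multisets_of_size_def)
    moreover have "set_mset C \<subseteq> range (\<lambda>j. a + m * j)"
    proof -
      have "set_mset A \<subseteq> range (\<lambda>j. b + m * j)" "set_mset B \<subseteq> (\<lambda>j. a + m * j) ` {..<\<nu> + t + 1}"
        using AB by (simp_all add: multisets_of_size_def T_def)
      moreover have "(\<lambda>j. a + m * j) ` {..<\<nu> + t + 1} \<subseteq> range (\<lambda>j. a + m * j)"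
        by (rule image_mono) simp
      ultimately show ?thesis
        unfolding \<open>C = A + B\<close> set_mset_union using range_b' by (meson Un_least subset_trans)
    qed
    moreover have "(\<lambda>j. a + m * j) ` {..\<nu>} \<subseteq> set_mset C"
      using AB by (simp add: T_def le_supI2)
    ultimately show "C \<in> ?L"
      unfolding durfee_class_def b_def by simp
  qed
  show "inj_on (\<lambda>(A, B). A + B) (multisets_of_size (range (\<lambda>j. b + m * j)) t \<times> T)"
    by (rule inj_on_inverseI[where g = "\<lambda>C. ({#x \<in># C. b \<le> x#}, {#x \<in># C. \<not> b \<le> x#})"])
      (use filter_top in auto)
qed

text \<open>Taking away one copy of each element of \<open>I\<close> leaves an arbitrary multiset
  over \<open>S\<close>.\<close>

lemma msets_containing_eq_image:
  assumes "finite I" and "I \<subseteq> S"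
  shows "{B. set_mset B \<subseteq> S \<and> I \<subseteq> set_mset B} = (+) (mset_set I) ` {B. set_mset B \<subseteq> S}"
proof (intro equalityI subsetI)
  fix B assume B: "B \<in> {B. set_mset B \<subseteq> S \<and> I \<subseteq> set_mset B}"
  then have "mset_set I \<subseteq># B"
    by (auto intro: subset_mset.order_trans[OF subset_imp_msubset_mset_set mset_set_set_mset_msubset])
  then have "B = mset_set I + (B - mset_set I)" by simp
  moreover have "set_mset (B - mset_set I) \<subseteq> S"
    using B in_diffD by fastforce
  ultimately show "B \<in> (+) (mset_set I) ` {B. set_mset B \<subseteq> S}" by blast
qed (use assms in auto)

text \<open>The total of the mandatory parts yields the exponent in front of the series. The doubled
  identity shows that the halved product is even, so \<open>div 2\<close> is exact.\<close>

lemma sum_progression: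
  fixes a m \<nu> :: nat
  shows "(\<Sum>j\<le>\<nu>. a + m * j) = a + \<nu> * (m * \<nu> + m + 2 * a) div 2"
proof -
  have "2 * (\<Sum>j\<le>\<nu>. a + m * j) = 2 * a + \<nu> * (m * \<nu> + m + 2 * a)"
    by (induction \<nu>) (auto simp: algebra_simps)
  then show ?thesis by linarith
qed

lemma mset_gf_durfee_class:
  assumes "0 < a" and "0 < m"
  shows "mset_gf (durfee_class a m \<nu> t)
      * (qpochhammer t (fps_X ^ m) (fps_X ^ m) * qpochhammer (\<nu> + t + 1) (fps_X ^ a) (fps_X ^ m))
    = fps_X ^ (a + \<nu> * (m * \<nu> + m + 2 * a) div 2) * fps_X ^ (t * (m * \<nu> + m * t + m + a))"
proof -
  define b where "b = a + m * (t + \<nu> + 1)"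
  define I where "I = (\<lambda>j. a + m * j) ` {..\<nu>}"
  define S where "S = (\<lambda>j. a + m * j) ` {..<\<nu> + t + 1}"
  define T where "T = {B. set_mset B \<subseteq> S \<and> I \<subseteq> set_mset B}"
  let ?P = "multisets_of_size (range (\<lambda>j. b + m * j)) t"
  have "mset_gf (durfee_class a m \<nu> t) = mset_gf ?P * (mset_gf T :: 'a fps)"
    unfolding durfee_class_eq_image(1)[OF assms(2)] T_def S_def I_def b_def
    by (rule mset_gf_plus, rule durfee_class_eq_image(2)[OF assms(2)])
      (use assms in \<open>auto simp: multisets_of_size_def\<close>)
  also have "mset_gf T = fps_X ^ (a + \<nu> * (m * \<nu> + m + 2 * a) div 2) * mset_gf {B. set_mset B \<subseteq> S}"
  proof -
    have "sum_mset (mset_set I) = (\<Sum>j\<le>\<nu>. a + m * j)"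
      unfolding I_def using assms
      by (subst sum_unfold_sum_mset[symmetric, where f = "\<lambda>x. x", simplified], subst sum.reindex)
        (auto intro: inj_onI)
    moreover have "T = (+) (mset_set I) ` {B. set_mset B \<subseteq> S}"
      unfolding T_def by (rule msets_containing_eq_image) (auto simp: I_def S_def)
    ultimately show ?thesis
      by (auto simp: sum_progression intro!: mset_gf_image_shift inj_onI)
  qed
  \<comment> \<open>Regrouping pairs the top piece with the symbol starting at
    \<open>fps_X ^ m\<close> and the free bottom parts with the one starting at
    \<open>fps_X ^ a\<close>, so that each pair collapses.\<close>
  also have "mset_gf ?P * (fps_X ^ (a + \<nu> * (m * \<nu> + m + 2 * a) div 2) * mset_gf {B. set_mset B \<subseteq> S})
      * (qpochhammer t (fps_X ^ m) (fps_X ^ m) * qpochhammer (\<nu> + t + 1) (fps_X ^ a) (fps_X ^ m))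
    = fps_X ^ (a + \<nu> * (m * \<nu> + m + 2 * a) div 2)
      * (mset_gf ?P * qpochhammer t (fps_X ^ m) (fps_X ^ m))
      * (mset_gf {B. set_mset B \<subseteq> S} * qpochhammer (\<nu> + t + 1) (fps_X ^ a) (fps_X ^ m) :: 'a fps)"
    by (simp only: ac_simps)
  also have "\<dots> = fps_X ^ (a + \<nu> * (m * \<nu> + m + 2 * a) div 2) * fps_X ^ (t * b)"
    unfolding S_def using assms
    by (simp only: mset_gf_parts_in_progression mset_gf_multisets_of_size_progression b_def)
      (simp add: mset_gf_multisets_of_size_progression)
  also have "t * b = t * (m * \<nu> + m * t + m + a)"
    by (simp add: b_def algebra_simps)
  finally show ?thesis .
qed

section \<open>Matching the Durfee classes with the partitions counted by \<open>M\<close>\<close>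

lemma durfee_class_disjoint:
  assumes "A \<in> durfee_class a m \<nu> t" and "A \<in> durfee_class a m \<nu> u"
  shows "t = u"
proof -
  have "s \<le> r" if "r \<le> s" "A \<in> durfee_class a m \<nu> r" "A \<in> durfee_class a m \<nu> s" for r s
  proof -
    \<comment> \<open>The threshold grows with the index, so the larger index \<open>s\<close>
      counts no more parts than \<open>r\<close> does.\<close>
    have "a + m * (r + \<nu> + 1) \<le> a + m * (s + \<nu> + 1)" using that by simp
    then have "{#x \<in># A. a + m * (s + \<nu> + 1) \<le> x#} \<subseteq># {#x \<in># A. a + m * (r + \<nu> + 1) \<le> x#}"
      by (intro filter_mset_mono_strong subset_mset.order_refl) (rule order_trans)
    from size_mset_mono[OF this] show ?thesis
      using that by (simp add: durfee_class_def)
  qed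
  from this[of t u] this[of u t] show ?thesis using assms by linarith
qed

text \<open>In a weakly decreasing list the entries that are at least \<open>b\<close> form an
  initial segment, so their number locates the cut.\<close>

lemma size_filter_mset_sorted_desc_iff:
  fixes xs :: "nat list"
  assumes "sorted_wrt (\<ge>) xs"
  shows "size {#x \<in># mset xs. b \<le> x#} = t \<longleftrightarrow>
    t \<le> length xs \<and> (\<forall>i<t. b \<le> xs ! i) \<and> (\<forall>i. t \<le> i \<and> i < length xs \<longrightarrow> xs ! i < b)"
  using assms
proof (induction xs arbitrary: t)
  case Nil
  then show ?case by auto
next
  case (Cons x xs)
  show ?case
  proof (cases "b \<le> x")
    case True
    show ?thesis
    proof (cases t)
      case (Suc u)
      then show ?thesis using True Cons
        by (auto simp: All_less_Suc2 less_Suc_eq_0_disj nth_Cons split: nat.splits)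
    qed (use True in auto)
  next
    case False
    then have small: "\<forall>y\<in>set (x # xs). \<not> b \<le> y" using Cons.prems by force
    then have "{#y \<in># mset (x # xs). b \<le> y#} = {#}"
      by simp
    moreover have "\<forall>i<length (x # xs). (x # xs) ! i < b"
      using small by (metis not_le nth_mem)
    ultimately have "size {#y \<in># mset (x # xs). b \<le> y#} = 0" "\<forall>i<length (x # xs). \<not> b \<le> (x # xs) ! i"
      by (simp_all only: size_empty not_le)
    then show ?thesis using False by (cases t) (auto simp only: not_le, auto)
  qed
qed

text \<open>Strict shortness below the rectangle turns the maximum defining the Durfee height into a
  fixed point: a \<open>t\<close> such that exactly \<open>t\<close> rows have at least
  \<open>t + \<nu> + 2\<close> boxes. There is none precisely when the row just below the rectangle
  is as wide as the rectangle.\<close>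

lemma durfee_condition_iff:
  assumes sorted: "sorted_wrt (\<ge>) xs" and parts: "set xs \<subseteq> range (\<lambda>j. a + m * j)" and "0 < m"
  shows "(let t = durfee_height a m (\<nu> + 2) xs
          in \<forall>i. t \<le> i \<and> i < length xs \<longrightarrow> row_length a m (xs ! i) < t + \<nu> + 2)
    \<longleftrightarrow> (\<exists>t. size {#x \<in># mset xs. a + m * (t + \<nu> + 1) \<le> x#} = t)" (is "?L \<longleftrightarrow> ?R")
proof -
  define c where "c t = a + m * (t + \<nu> + 1)" for t
  have row: "t + (\<nu> + 2) \<le> row_length a m (xs ! i) \<longleftrightarrow> c t \<le> xs ! i"
    if "i < length xs" for i t
  proof -
    obtain j where "xs ! i = a + m * j" using parts nth_mem[OF \<open>i < length xs\<close>] by blast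
    then show ?thesis using \<open>0 < m\<close> by (simp add: row_length_def c_def del: mult_Suc_right)
  qed
  define H where "H = {t. t \<le> length xs \<and> (t = 0 \<or> t + (\<nu> + 2) \<le> row_length a m (xs ! (t - 1)))}"
  define d where "d = durfee_height a m (\<nu> + 2) xs"
  have d: "d = Max H" by (simp add: d_def durfee_height_def H_def)
  have fin: "finite H" by (rule finite_subset[of _ "{..length xs}"]) (auto simp: H_def)
  have "0 \<in> H" by (simp add: H_def)
  then have "d \<in> H" using fin Max_in d by blast
  have mono: "xs ! j \<le> xs ! i" if "i \<le> j" "j < length xs" for i j
    using sorted_wrt_nth_less[OF sorted, of i j] that by (cases "i = j") auto
  show ?thesis
  proof
    assume L: ?L
    have "c d \<le> xs ! i" if "i < d" for i
    proof -
      have "c d \<le> xs ! (d - 1)"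
        using \<open>d \<in> H\<close> that row[of "d - 1" d] by (auto simp: H_def)
      also have "\<dots> \<le> xs ! i"
        using \<open>d \<in> H\<close> that by (intro mono) (auto simp: H_def)
      finally show ?thesis .
    qed
    moreover have "xs ! i < c d" if "d \<le> i" "i < length xs" for i
      using L that row[of i d] unfolding Let_def d_def[symmetric] by force
    ultimately have "size {#x \<in># mset xs. c d \<le> x#} = d"
      using size_filter_mset_sorted_desc_iff[OF sorted, of "c d" d] \<open>d \<in> H\<close>
      by (auto simp: H_def)
    then show ?R unfolding c_def by blast
  next
    assume ?R
    then obtain t where t: "size {#x \<in># mset xs. c t \<le> x#} = t" unfolding c_def by blast
    then have t': "t \<le> length xs" "\<And>i. i < t \<Longrightarrow> c t \<le> xs ! i"
      "\<And>i. t \<le> i \<Longrightarrow> i < length xs \<Longrightarrow> xs ! i < c t"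
      using size_filter_mset_sorted_desc_iff[OF sorted] by blast+
    \<comment> \<open>A fixed point \<open>t\<close> is the maximum of \<open>H\<close>: a height
      \<open>u > t\<close> would need row \<open>u\<close> to reach \<open>c u\<close>, but that row
      lies below the cut and is less than \<open>c t < c u\<close>.\<close>
    have "t \<in> H"
      using t' row[of "t - 1" t] by (cases "t = 0") (auto simp: H_def)
    moreover have "u \<le> t" if "u \<in> H" for u
    proof (rule ccontr)
      assume "\<not> u \<le> t"
      then have "c u \<le> xs ! (u - 1)"
        using that row[of "u - 1" u] by (auto simp: H_def)
      moreover have "xs ! (u - 1) < c t"
        using \<open>\<not> u \<le> t\<close> that by (intro t'(3)) (auto simp: H_def)
      ultimately have "c u < c t" by linarith
      then show False using \<open>\<not> u \<le> t\<close> by (simp add: c_def)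
    qed
    ultimately have "d = t" using fin d by (simp add: Max_eqI)
    then show ?L
      unfolding Let_def d_def[symmetric] using t'(3) row[of _ t] by (metis add.assoc not_le)
  qed
qed

lemma cong_positive_iff_progression:
  fixes a m x :: nat
  assumes "0 < a" and "a < m"
  shows "0 < x \<and> [x = a] (mod m) \<longleftrightarrow> x \<in> range (\<lambda>j. a + m * j)"
proof
  assume "0 < x \<and> [x = a] (mod m)"
  then have "x mod m = a" using assms by (simp add: cong_def)
  then have "x = a + m * (x div m)" using mod_mult_div_eq[of x m] by simp
  then show "x \<in> range (\<lambda>j. a + m * j)" by blast
qed (use assms in \<open>auto simp: cong_def\<close>)

text \<open>A weakly decreasing list is determined by its multiset; the inverse map lists the
  elements in decreasing order.\<close>

lemma bij_betw_M_partitions: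
  assumes "0 < a" and "a < m"
  shows "bij_betw mset (M_partitions a m \<nu> n) {A \<in> (\<Union>t. durfee_class a m \<nu> t). sum_mset A = n}"
proof -
  have "0 < m" using assms by simp
  have char: "xs \<in> M_partitions a m \<nu> n \<longleftrightarrow>
      sorted_wrt (\<ge>) xs \<and> mset xs \<in> (\<Union>t. durfee_class a m \<nu> t) \<and> sum_mset (mset xs) = n" for xs
  proof (cases "sorted_wrt (\<ge>) xs \<and> set xs \<subseteq> range (\<lambda>j. a + m * j)")
    case True
    then have "0 < x \<and> [x = a] (mod m)" if "x \<in> set xs" for x
      unfolding cong_positive_iff_progression[OF assms] using that by blast
    then have parts: "\<forall>x\<in>set xs. 0 < x" "\<forall>x\<in>set xs. [x = a] (mod m)" by simp_all
    have "mset xs \<in> (\<Union>t. durfee_class a m \<nu> t) \<longleftrightarrow> (\<forall>j\<le>\<nu>. a + m * j \<in> set xs)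
        \<and> (\<exists>t. size {#x \<in># mset xs. a + m * (t + \<nu> + 1) \<le> x#} = t)"
      unfolding durfee_class_def using True by (simp add: image_subset_iff Ball_def)
    then show ?thesis
      unfolding M_partitions_def is_partition_def mem_Collect_eq sum_mset_sum_list
        durfee_condition_iff[OF conjunct1[OF True] conjunct2[OF True] \<open>0 < m\<close>]
      using True parts by argo
  next
    case False
    \<comment> \<open>In this case both sides of \<open>char\<close> are false.\<close>
    have "sorted_wrt (\<ge>) xs \<and> set xs \<subseteq> range (\<lambda>j. a + m * j)" if "xs \<in> M_partitions a m \<nu> n"
      using that unfolding subset_iff cong_positive_iff_progression[OF assms, symmetric]
      by (simp add: M_partitions_def is_partition_def)
    moreover have "set xs \<subseteq> range (\<lambda>j. a + m * j)" if "mset xs \<in> (\<Union>t. durfee_class a m \<nu> t)"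
      using that by (simp add: durfee_class_def)
    ultimately show ?thesis using False by blast
  qed
  show ?thesis
  proof (rule bij_betw_byWitness[where f' = "\<lambda>A. rev (sorted_list_of_multiset A)"])
    show "\<forall>xs\<in>M_partitions a m \<nu> n. rev (sorted_list_of_multiset (mset xs)) = xs"
    proof
      fix xs assume "xs \<in> M_partitions a m \<nu> n"
      then have "sorted (rev xs)" by (simp add: char sorted_wrt_rev)
      then have "sort xs = rev xs" by (metis mset_rev properties_for_sort)
      then show "rev (sorted_list_of_multiset (mset xs)) = xs" by simp
    qed
    show "mset ` M_partitions a m \<nu> n \<subseteq> {A \<in> (\<Union>t. durfee_class a m \<nu> t). sum_mset A = n}"
      by (auto simp: char)
    show "(\<lambda>A. rev (sorted_list_of_multiset A)) ` {A \<in> (\<Union>t. durfee_class a m \<nu> t). sum_mset A = n}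
        \<subseteq> M_partitions a m \<nu> n"
      unfolding char image_subset_iff
      by (auto simp: sorted_wrt_rev)
  qed simp
qed

lemma durfee_class_no_zero:
  assumes "0 < a" and "A \<in> durfee_class a m \<nu> t"
  shows "0 \<notin># A"
  using assms by (auto simp: durfee_class_def)

text \<open>Only the finitely many classes with \<open>t \<le> n\<close> can contain multisets of
  sum \<open>n\<close>, so coefficient \<open>n\<close> is a finite sum.\<close>

lemma durfee_class_index_le_sum:
  assumes "0 < a" and "A \<in> durfee_class a m \<nu> t"
  shows "t \<le> sum_mset A"
proof -
  have "t \<le> size A"
    using assms(2) size_filter_mset_lesseq[of "\<lambda>x. a + m * (t + \<nu> + 1) \<le> x" A]
    by (simp add: durfee_class_def)
  also have "\<dots> \<le> sum_mset A"
    by (rule size_le_sum_mset[OF durfee_class_no_zero[OF assms]])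
  finally show ?thesis .
qed

lemma M_eq_sum:
  assumes "0 < a" and "a < m"
  shows "of_nat (M a m \<nu> n) = (\<Sum>t\<le>n. mset_gf (durfee_class a m \<nu> t) $ n)"
proof -
  have "M a m \<nu> n = card {A \<in> (\<Union>t. durfee_class a m \<nu> t). sum_mset A = n}"
    unfolding M_def by (rule bij_betw_same_card[OF bij_betw_M_partitions[OF assms]])
  also have "{A \<in> (\<Union>t. durfee_class a m \<nu> t). sum_mset A = n}
      = (\<Union>t\<in>{..n}. {A \<in> durfee_class a m \<nu> t. sum_mset A = n})"
    using durfee_class_index_le_sum[OF assms(1)] by blast
  also have "card \<dots> = (\<Sum>t\<le>n. card {A \<in> durfee_class a m \<nu> t. sum_mset A = n})"
    by (intro card_UN_disjoint ballI finite_msets_sum durfee_class_no_zero[OF assms(1)])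
      (auto dest: durfee_class_disjoint)
  finally show ?thesis by (simp add: mset_gf_def)
qed

section \<open>Summation of the series\<close>

text \<open>Convergence of formal power series means that each coefficient is eventually constant;
  coefficient \<open>n\<close> of the partial sums is settled once \<open>N > n\<close>.\<close>

lemma fps_sums_coeffwise:
  fixes f :: "nat \<Rightarrow> 'a::comm_ring_1 fps"
  assumes "\<And>t n. n < t \<Longrightarrow> f t $ n = 0"
  shows "f sums Abs_fps (\<lambda>n. \<Sum>t\<le>n. f t $ n)"
  unfolding sums_def
proof (rule tendsto_fpsI)
  fix n :: nat
  show "\<forall>\<^sub>F N in sequentially. (\<Sum>t<N. f t) $ n = Abs_fps (\<lambda>n. \<Sum>t\<le>n. f t $ n) $ n"
    using eventually_gt_at_top[of n]
  proof eventually_elim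
    case (elim N)
    then have "(\<Sum>t<N. f t $ n) = (\<Sum>t\<le>n. f t $ n)"
      by (intro sum.mono_neutral_right) (auto simp: assms)
    then show ?case by (simp add: fps_sum_nth)
  qed
qed

text \<open>Constant term 1 makes the denominators units, so that division in the summand is
  multiplication by the inverse.\<close>

lemma qpochhammer_nth_0:
  assumes "x $ 0 = 0"
  shows "qpochhammer n x q $ 0 = 1"
  using assms by (induction n) (simp_all add: qpochhammer_def)

text \<open>Summability is claimed alongside the identity because the infinite sum has no meaningful
  value for a divergent series.\<close>

theorem theorem1p1:
  fixes a m \<nu> :: nat
  assumes "0 < a" and "a < m"
  defines "summand \<equiv> (\<lambda>\<tau>. fps_X ^ (\<tau> * (m * \<nu> + m * \<tau> + m + a))
             / (qpochhammer \<tau> (fps_X ^ m) (fps_X ^ m)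
                * qpochhammer (\<nu> + \<tau> + 1) (fps_X ^ a) (fps_X ^ m)) :: rat fps)"
  shows "summable summand
    \<and> Abs_fps (\<lambda>n. of_nat (M a m \<nu> n)) =
        fps_X ^ (a + \<nu> * (m * \<nu> + m + 2 * a) div 2) * (\<Sum>\<tau>. summand \<tau>)"
proof -
  define s where "s = a + \<nu> * (m * \<nu> + m + 2 * a) div 2"
  define D :: "nat \<Rightarrow> rat fps" where
    "D t = qpochhammer t (fps_X ^ m) (fps_X ^ m) * qpochhammer (\<nu> + t + 1) (fps_X ^ a) (fps_X ^ m)" for t
  have "0 < m" using assms by simp
  have D0: "D t $ 0 \<noteq> 0" for t
    using assms(1) \<open>0 < m\<close> by (simp add: D_def qpochhammer_nth_0)
  have summand: "summand t = fps_X ^ (t * (m * \<nu> + m * t + m + a)) * inverse (D t)" for t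
    unfolding summand_def D_def[symmetric] by (rule fps_divide_unit[OF D0])
  have gf: "mset_gf (durfee_class a m \<nu> t) = fps_X ^ s * summand t" for t
  proof -
    have "mset_gf (durfee_class a m \<nu> t) * D t * inverse (D t)
        = fps_X ^ s * fps_X ^ (t * (m * \<nu> + m * t + m + a)) * inverse (D t)"
      unfolding D_def s_def mset_gf_durfee_class[OF assms(1) \<open>0 < m\<close>] ..
    then show ?thesis
      unfolding summand using inverse_mult_eq_1'[OF D0[of t]] by (simp add: mult.assoc)
  qed
  \<comment> \<open>Positivity of \<open>a\<close> makes the exponent of \<open>fps_X\<close> at
    least \<open>t\<close>.\<close>
  have zero: "summand t $ n = 0" if "n < t" for n t
  proof -
    have "t * 1 \<le> t * (m * \<nu> + m * t + m + a)" using assms(1) by (intro mult_le_mono2) simp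
    then have "n < t * (m * \<nu> + m * t + m + a)" using that by linarith
    then show ?thesis by (simp add: summand fps_X_power_mult_nth)
  qed
  have sums: "summand sums Abs_fps (\<lambda>n. \<Sum>t\<le>n. summand t $ n)"
    by (rule fps_sums_coeffwise[OF zero])
  have "Abs_fps (\<lambda>n. of_nat (M a m \<nu> n)) = fps_X ^ s * Abs_fps (\<lambda>n. \<Sum>t\<le>n. summand t $ n)"
  proof (rule fps_ext)
    fix n
    \<comment> \<open>The factor \<open>fps_X ^ s\<close> lowers the coefficient index to
      \<open>n - s\<close>, where the terms with \<open>t > n - s\<close> vanish; this reconciles
      the two summation ranges.\<close>
    have "(\<Sum>t\<le>n. summand t $ (n - s)) = (\<Sum>t\<le>n - s. summand t $ (n - s))"
      by (intro sum.mono_neutral_right) (auto simp: zero)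
    then show "Abs_fps (\<lambda>n. of_nat (M a m \<nu> n)) $ n
        = (fps_X ^ s * Abs_fps (\<lambda>n. \<Sum>t\<le>n. summand t $ n)) $ n"
      by (simp add: M_eq_sum[OF assms(1,2)] gf fps_X_power_mult_nth)
  qed
  then show ?thesis
    using sums by (auto simp: s_def sums_iff)
qed

end
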